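(* Let $I\subset\mathbb{R}$ be an open interval and let $\alpha:I\to\mathbb{R}^3$ be a smooth curve parametrized by arc length $s$, with nowhere vanishing curvature, and let $\{\mathbf{t},\mathbf{n},\mathbf{b},\kappa,\tau\}$ be its Frenet–Serret apparatus. Then the ruled surface generated by the curvature axes of $\alpha$, $$\mathbf{R}(s,\lambda)=\alpha(s)+\frac{1}{\kappa(s)}\,\mathbf{n}(s)+\lambda\,\mathbf{b}(s),\qquad s\in I,\ \lambda\in\mathbb{R},$$ is a developable surface.
   Context: The Frenet–Serret apparatus consists of the unit tangent $\mathbf{t}$, principal normal $\mathbf{n}$, binormal $\mathbf{b}$, curvature $\kappa$ and torsion $\tau$, satisfying $\mathbf{t}'=\kappa\mathbf{n}$, $\mathbf{n}'=-\kappa\mathbf{t}+\tau\mathbf{b}$, $\mathbf{b}'=-\tau\mathbf{n}$, where $'=d/ds$ is the derivative with respect to arc length. The curvature axis of $\alpha$ at $s_0$ is the line $\{\alpha(s_0)+\frac{1}{\kappa(s_0)}\mathbf{n}(s_0)+\lambda\mathbf{b}(s_0):\lambda\in\mathbb{R}\}$. A ruled surface is a surface admitting a parametrization $\mathbf{R}(s,\lambda)=\mathbf{x}(s)+\lambda\,\mathbf{y}(s)$ with $\|\mathbf{y}(s)\|=1$, where $\mathbf{x}$ is the base curve and $\mathbf{y}$ the directrix. It is called developable if $\det(\mathbf{x}'(s),\mathbf{y}(s),\mathbf{y}'(s))=0$ for all $s$. (No regularity of the parametrized surface is required.) *)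

theory Defs
  imports "HOL-Analysis.Analysis"
begin

(* C-infinity on an open set I: every iterated derivative exists at every point of I.
   The values of f outside I play no role. *)
definition smooth_on :: "real set \<Rightarrow> (real \<Rightarrow> 'a::real_normed_vector) \<Rightarrow> bool" where
  "smooth_on I f \<longleftrightarrow>
     (\<forall>k. \<forall>s\<in>I. ((\<lambda>g u. vector_derivative g (at u)) ^^ k) f differentiable (at s))"

definition arc_length_parametrized :: "real set \<Rightarrow> (real \<Rightarrow> real^3) \<Rightarrow> bool" where
  "arc_length_parametrized I \<alpha> \<longleftrightarrow> (\<forall>s\<in>I. norm (vector_derivative \<alpha> (at s)) = 1)"

(* Only the defining formulas are recorded, so the Frenet-Serret equations are not assumed.
   The sign of the torsion is the one for which b' = - \<tau> n. *)
definition frenet_apparatus ::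
  "real set \<Rightarrow> (real \<Rightarrow> real^3) \<Rightarrow> (real \<Rightarrow> real^3) \<Rightarrow> (real \<Rightarrow> real^3) \<Rightarrow> (real \<Rightarrow> real^3)
     \<Rightarrow> (real \<Rightarrow> real) \<Rightarrow> (real \<Rightarrow> real) \<Rightarrow> bool" where
  "frenet_apparatus I \<alpha> t n b \<kappa> \<tau> \<longleftrightarrow>
     (\<forall>s\<in>I. t s = vector_derivative \<alpha> (at s) \<and>
            \<kappa> s = norm (vector_derivative t (at s)) \<and>
            n s = (1 / \<kappa> s) *\<^sub>R vector_derivative t (at s) \<and>
            b s = cross3 (t s) (n s) \<and>
            \<tau> s = - (vector_derivative b (at s) \<bullet> n s))"

definition curvature_axis ::
  "(real \<Rightarrow> real^3) \<Rightarrow> (real \<Rightarrow> real^3) \<Rightarrow> (real \<Rightarrow> real^3) \<Rightarrow> (real \<Rightarrow> real) \<Rightarrow> real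
     \<Rightarrow> (real^3) set" where
  "curvature_axis \<alpha> n b \<kappa> s0 =
     {\<alpha> s0 + (1 / \<kappa> s0) *\<^sub>R n s0 + l *\<^sub>R b s0 | l. l \<in> UNIV}"

(* R parametrizes, over I \<times> \<real>, the ruled surface with base curve x and directrix y. *)
definition ruled_surface ::
  "real set \<Rightarrow> (real \<Rightarrow> real^3) \<Rightarrow> (real \<Rightarrow> real^3) \<Rightarrow> (real \<Rightarrow> real \<Rightarrow> real^3) \<Rightarrow> bool" where
  "ruled_surface I x y R \<longleftrightarrow>
     smooth_on I x \<and> smooth_on I y \<and>
     (\<forall>s\<in>I. norm (y s) = 1) \<and>
     (\<forall>s\<in>I. \<forall>l. R s l = x s + l *\<^sub>R y s)"

definition developable ::
  "real set \<Rightarrow> (real \<Rightarrow> real^3) \<Rightarrow> (real \<Rightarrow> real^3) \<Rightarrow> (real \<Rightarrow> real \<Rightarrow> real^3) \<Rightarrow> bool" where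
  "developable I x y R \<longleftrightarrow>
     ruled_surface I x y R \<and>
     (\<forall>s\<in>I. det (vector [vector_derivative x (at s), y s, vector_derivative y (at s)]
                   :: real^3^3) = 0)"

end

theory Submission
  imports Defs
begin

text \<open>
  The base curve is the curve \<open>x = \<alpha> + (1/\<kappa>) n\<close> of centres of curvature and the directrix
  is \<open>b = t \<times> n\<close>.  Differentiating \<open>b\<close>, the term \<open>t' \<times> n\<close> vanishes because \<open>t' = \<kappa> n\<close>, so that
  \<open>b' = t \<times> n'\<close>.  Hence both \<open>b\<close> and \<open>b'\<close> are orthogonal to \<open>t\<close>, and \<open>b \<times> b'\<close> is a multiple of
  \<open>t\<close>.  The determinant \<open>x' \<bullet> (b \<times> b')\<close> is therefore a multiple of \<open>x' \<bullet> t\<close>.  In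
  \<open>x' = t + (1/\<kappa>)' n + (1/\<kappa>) n'\<close> the second term is orthogonal to \<open>t\<close>, and differentiating
  \<open>t \<bullet> n = 0\<close> gives \<open>t \<bullet> n' = - \<kappa>\<close>; the first and the third term cancel in the direction of \<open>t\<close>.
  Geometrically, the centre of curvature has no velocity along the tangent.  This is the lemma
  \<open>det_curvature_axis_eq_0\<close>.

  A ruled surface also needs a smooth base curve and a smooth directrix.  Since
  \<open>1/\<kappa> = (t' \<bullet> t') powr (-1/2)\<close>, everything in the frame is built from derivatives of \<open>\<alpha>\<close> by
  sums, bilinear products and real powers of a positive function.  Closure of smoothness under
  these operations is proved by induction on the order of differentiability.
\<close>

section \<open>Smooth functions of a real variable\<close>

text \<open>
  A smooth function is one that is \<open>k\<close> times differentiable for all \<open>k\<close>.  The recursion takes the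
  derivative first, so that induction on \<open>k\<close> can use the product and chain rules once and leave
  the rest to the induction hypothesis.
\<close>

primrec times_differentiable_on ::
    "nat \<Rightarrow> real set \<Rightarrow> (real \<Rightarrow> 'a::real_normed_vector) \<Rightarrow> bool" where
  "times_differentiable_on 0 I f \<longleftrightarrow> True"
| "times_differentiable_on (Suc k) I f \<longleftrightarrow>
     (\<forall>s\<in>I. f differentiable (at s)) \<and>
     times_differentiable_on k I (\<lambda>s. vector_derivative f (at s))"

lemma times_differentiable_on_iff_funpow:
  "times_differentiable_on k I f \<longleftrightarrow>
     (\<forall>j<k. \<forall>s\<in>I. ((\<lambda>g u. vector_derivative g (at u)) ^^ j) f differentiable (at s))"
proof (induction k arbitrary: f)
  case (Suc k)
  show ?case
    unfolding times_differentiable_on.simps Suc All_less_Suc2 funpow_Suc_right o_apply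
    by simp
qed simp

lemma smooth_on_iff_times_differentiable_on:
  "smooth_on I f \<longleftrightarrow> (\<forall>k. times_differentiable_on k I f)"
  unfolding smooth_on_def times_differentiable_on_iff_funpow by blast

lemma times_differentiable_on_SucD:
  "times_differentiable_on (Suc k) I f \<Longrightarrow> times_differentiable_on k I f"
  by (simp add: times_differentiable_on_iff_funpow)

text \<open>
  On an open set the derivatives at a point of \<open>I\<close> depend only on the values on \<open>I\<close>.  The frame
  is described by formulas on \<open>I\<close> alone, and this lemma transfers smoothness from the formulas to
  the given functions.
\<close>

lemma times_differentiable_on_cong:
  assumes "open I" and "\<And>s. s \<in> I \<Longrightarrow> f s = g s" and "times_differentiable_on k I f"
  shows "times_differentiable_on k I g"
  using assms(2,3)
proof (induction k arbitrary: f g)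
  case (Suc k)
  have der: "(g has_vector_derivative vector_derivative f (at s)) (at s)" if "s \<in> I" for s
  proof (rule has_vector_derivative_transform_within_open[OF _ assms(1) that])
    show "(f has_vector_derivative vector_derivative f (at s)) (at s)"
      using Suc.prems(2) that by (simp add: vector_derivative_works)
  qed (use Suc.prems(1) in auto)
  have "times_differentiable_on k I (\<lambda>s. vector_derivative g (at s))"
  proof (rule Suc.IH)
    show "times_differentiable_on k I (\<lambda>s. vector_derivative f (at s))"
      using Suc.prems(2) by simp
  qed (use vector_derivative_at[OF der] in simp)
  then show ?case
    using der by (auto intro: differentiableI_vector)
qed simp

lemma times_differentiable_on_SucI:
  assumes "open I" and der: "\<And>s. s \<in> I \<Longrightarrow> (f has_vector_derivative f' s) (at s)"
    and "times_differentiable_on k I f'"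
  shows "times_differentiable_on (Suc k) I f"
proof -
  have "times_differentiable_on k I (\<lambda>s. vector_derivative f (at s))"
    by (rule times_differentiable_on_cong[OF assms(1) _ assms(3)])
      (use vector_derivative_at[OF der] in simp)
  then show ?thesis
    using der by (auto intro: differentiableI_vector)
qed

lemma times_differentiable_on_SucE:
  assumes "times_differentiable_on (Suc k) I f" and "s \<in> I"
  shows "(f has_vector_derivative vector_derivative f (at s)) (at s)"
  using assms by (simp add: vector_derivative_works)

lemma times_differentiable_on_const: "times_differentiable_on k I (\<lambda>s. c)"
  by (induction k arbitrary: c) simp_all

lemma times_differentiable_on_add:
  assumes "open I" and "times_differentiable_on k I f" and "times_differentiable_on k I g"
  shows "times_differentiable_on k I (\<lambda>s. f s + g s)"
  using assms(2,3)
proof (induction k arbitrary: f g)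
  case (Suc k)
  show ?case
  proof (rule times_differentiable_on_SucI[OF assms(1)])
    show "((\<lambda>s. f s + g s) has_vector_derivative
        vector_derivative f (at s) + vector_derivative g (at s)) (at s)" if "s \<in> I" for s
      using Suc.prems[THEN times_differentiable_on_SucE, OF that]
      by (rule has_vector_derivative_add)
  qed (use Suc in simp)
qed simp

lemma (in bounded_bilinear) times_differentiable_on:
  assumes "open I" and "times_differentiable_on k I f" and "times_differentiable_on k I g"
  shows "times_differentiable_on k I (\<lambda>s. prod (f s) (g s))"
  using assms(2,3)
proof (induction k arbitrary: f g)
  case (Suc k)
  show ?case
  proof (rule times_differentiable_on_SucI[OF assms(1)])
    show "((\<lambda>s. prod (f s) (g s)) has_vector_derivative
        prod (f s) (vector_derivative g (at s)) + prod (vector_derivative f (at s)) (g s)) (at s)"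
      if "s \<in> I" for s
      using Suc.prems[THEN times_differentiable_on_SucE, OF that]
      by (rule has_vector_derivative)
    show "times_differentiable_on k I (\<lambda>s. prod (f s) (vector_derivative g (at s)) +
        prod (vector_derivative f (at s)) (g s))"
      using Suc.prems Suc.prems[THEN times_differentiable_on_SucD]
      by (intro times_differentiable_on_add assms(1) Suc.IH) simp_all
  qed
qed simp

text \<open>
  The exponent has to vary in the induction, since the derivative of \<open>f powr a\<close> contains
  \<open>f powr (a - 1)\<close>.
\<close>

lemma times_differentiable_on_powr:
  fixes f :: "real \<Rightarrow> real"
  assumes "open I" and "\<And>s. s \<in> I \<Longrightarrow> f s > 0" and "times_differentiable_on k I f"
  shows "times_differentiable_on k I (\<lambda>s. f s powr a)"
  using assms(3)
proof (induction k arbitrary: a)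
  case (Suc k)
  show ?case
  proof (rule times_differentiable_on_SucI[OF assms(1)])
    show "((\<lambda>s. f s powr a) has_vector_derivative
        a * f s powr (a - 1) * vector_derivative f (at s)) (at s)" if "s \<in> I" for s
      using times_differentiable_on_SucE[OF Suc.prems that] assms(2)[OF that]
        DERIV_fun_powr[of f "vector_derivative f (at s)" s a]
      by (simp add: has_real_derivative_iff_has_vector_derivative)
    show "times_differentiable_on k I (\<lambda>s. a * f s powr (a - 1) * vector_derivative f (at s))"
      using Suc.prems times_differentiable_on_SucD[OF Suc.prems]
      by (intro bounded_bilinear.times_differentiable_on[OF bounded_bilinear_mult]
          times_differentiable_on_const assms(1) Suc.IH) simp_all
  qed
qed simp

lemma smooth_on_cong:
  "\<lbrakk>open I; \<And>s. s \<in> I \<Longrightarrow> f s = g s; smooth_on I f\<rbrakk> \<Longrightarrow> smooth_on I g"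
  unfolding smooth_on_iff_times_differentiable_on by (blast intro: times_differentiable_on_cong)

lemma smooth_on_add:
  "\<lbrakk>open I; smooth_on I f; smooth_on I g\<rbrakk> \<Longrightarrow> smooth_on I (\<lambda>s. f s + g s)"
  unfolding smooth_on_iff_times_differentiable_on by (blast intro: times_differentiable_on_add)

lemma (in bounded_bilinear) smooth_on:
  "\<lbrakk>open I; smooth_on I f; smooth_on I g\<rbrakk> \<Longrightarrow> smooth_on I (\<lambda>s. prod (f s) (g s))"
  unfolding smooth_on_iff_times_differentiable_on by (blast intro: times_differentiable_on)

lemma smooth_on_powr:
  fixes f :: "real \<Rightarrow> real"
  shows "\<lbrakk>open I; \<And>s. s \<in> I \<Longrightarrow> f s > 0; smooth_on I f\<rbrakk> \<Longrightarrow> smooth_on I (\<lambda>s. f s powr a)"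
  unfolding smooth_on_iff_times_differentiable_on by (blast intro: times_differentiable_on_powr)

lemma smooth_on_vector_derivative:
  "smooth_on I f \<Longrightarrow> smooth_on I (\<lambda>s. vector_derivative f (at s))"
  unfolding smooth_on_iff_times_differentiable_on using times_differentiable_on.simps(2) by blast

lemma smooth_on_has_vector_derivative:
  "\<lbrakk>smooth_on I f; s \<in> I\<rbrakk> \<Longrightarrow> (f has_vector_derivative vector_derivative f (at s)) (at s)"
  unfolding smooth_on_iff_times_differentiable_on by (blast intro: times_differentiable_on_SucE)

lemma bounded_bilinear_cross3: "bounded_bilinear cross3"
  using bilinear_cross bilinear_conv_bounded_bilinear by blast

lemma has_vector_derivative_const_on_open:
  assumes "open I" and "s \<in> I" and "\<And>u. u \<in> I \<Longrightarrow> f u = c"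
    and "(f has_vector_derivative d) (at s)"
  shows "d = 0"
proof -
  have "((\<lambda>u. c) has_vector_derivative d) (at s)"
    by (rule has_vector_derivative_transform_within_open[OF assms(4,1,2,3)])
  then show ?thesis
    by (rule vector_derivative_unique_at[OF _ has_vector_derivative_const])
qed

section \<open>The determinant along the curvature axes\<close>

text \<open>
  The pointwise computation: \<open>n'\<close> and \<open>k'\<close> stand for the derivatives of the principal normal and
  of \<open>1/\<kappa>\<close>, and \<open>\<kappa> n\<close> for the derivative of \<open>t\<close>, so the three rows are \<open>x'\<close>, \<open>b\<close> and \<open>b'\<close>.
  The hypothesis on \<open>t \<bullet> n'\<close> is the derivative of \<open>t \<bullet> n = 0\<close>.
\<close>

lemma det_curvature_axis_eq_0:
  fixes t n n' :: "real^3"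
  assumes "t \<bullet> t = 1" and "t \<bullet> n = 0" and "t \<bullet> n' = - \<kappa>" and "\<kappa> \<noteq> 0"
  shows "det (vector [t + ((1 / \<kappa>) *\<^sub>R n' + k' *\<^sub>R n), cross3 t n,
                      cross3 t n' + cross3 (\<kappa> *\<^sub>R n) n] :: real^3^3) = 0"
proof -
  have "cross3 (cross3 t n) (cross3 t n') = (cross3 t n \<bullet> n') *\<^sub>R t"
    unfolding Lagrange by (simp add: dot_cross_self inner_commute)
  moreover have "(t + ((1 / \<kappa>) *\<^sub>R n' + k' *\<^sub>R n)) \<bullet> t = 0"
    using assms by (simp add: inner_add_left inner_commute[of n t] inner_commute[of n' t])
  ultimately show ?thesis
    by (simp add: dot_cross_det[symmetric] cross_mult_left)
qed

section \<open>Developability\<close>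

theorem theorem2:
  fixes I :: "real set"
    and \<alpha> t n b :: "real \<Rightarrow> real^3"
    and \<kappa> \<tau> :: "real \<Rightarrow> real"
    and R :: "real \<Rightarrow> real \<Rightarrow> real^3"
  assumes "open I" and "is_interval I"
    and "smooth_on I \<alpha>"
    and "arc_length_parametrized I \<alpha>"
    and "frenet_apparatus I \<alpha> t n b \<kappa> \<tau>"
    and "\<forall>s\<in>I. \<kappa> s \<noteq> 0"
    and "\<forall>s\<in>I. \<forall>l. R s l = \<alpha> s + (1 / \<kappa> s) *\<^sub>R n s + l *\<^sub>R b s"
  shows "(\<forall>s\<in>I. range (R s) = curvature_axis \<alpha> n b \<kappa> s) \<and>
         developable I (\<lambda>s. \<alpha> s + (1 / \<kappa> s) *\<^sub>R n s) b R"
proof -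
  define t' where "t' = (\<lambda>s. vector_derivative t (at s))"
  define n' where "n' = (\<lambda>s. vector_derivative n (at s))"
  define k where "k = (\<lambda>s. 1 / \<kappa> s)"
  define k' where "k' = (\<lambda>s. vector_derivative k (at s))"
  have t: "vector_derivative \<alpha> (at s) = t s" and \<kappa>: "\<kappa> s = norm (t' s)"
    and n: "k s *\<^sub>R t' s = n s" and b: "cross3 (t s) (n s) = b s" if "s \<in> I" for s
    using assms(5) that by (simp_all add: frenet_apparatus_def t'_def k_def)
  have \<kappa>_neq: "\<kappa> s \<noteq> 0" if "s \<in> I" for s
    using assms(6) that by blast
  have t'_eq: "t' s = \<kappa> s *\<^sub>R n s" if "s \<in> I" for s
    using \<kappa>_neq[OF that] by (simp add: n[OF that, symmetric] k_def)

  have smooth_t: "smooth_on I t"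
    by (rule smooth_on_cong[OF assms(1) t smooth_on_vector_derivative[OF assms(3)]])
  then have smooth_t': "smooth_on I t'"
    unfolding t'_def by (rule smooth_on_vector_derivative)
  have pos: "t' s \<bullet> t' s > 0" if "s \<in> I" for s
    using \<kappa>[OF that] \<kappa>_neq[OF that] by auto
  have k_eq: "(t' s \<bullet> t' s) powr (- 1 / 2) = k s" if "s \<in> I" for s
    using pos[OF that] \<kappa>[OF that]
    by (simp add: k_def powr_minus_divide powr_half_sqrt norm_eq_sqrt_inner)
  have smooth_q: "smooth_on I (\<lambda>s. t' s \<bullet> t' s)"
    by (rule bounded_bilinear.smooth_on[OF bounded_bilinear_inner assms(1) smooth_t' smooth_t'])
  have smooth_k: "smooth_on I k"
    by (rule smooth_on_cong[OF assms(1) k_eq smooth_on_powr[OF assms(1) pos smooth_q]])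
  have smooth_n: "smooth_on I n"
    by (rule smooth_on_cong[OF assms(1) n
          bounded_bilinear.smooth_on[OF bounded_bilinear_scaleR assms(1) smooth_k smooth_t']])
  have smooth_b: "smooth_on I b"
    by (rule smooth_on_cong[OF assms(1) b
          bounded_bilinear.smooth_on[OF bounded_bilinear_cross3 assms(1) smooth_t smooth_n]])
  have smooth_x: "smooth_on I (\<lambda>s. \<alpha> s + k s *\<^sub>R n s)"
    by (intro smooth_on_add bounded_bilinear.smooth_on[OF bounded_bilinear_scaleR]
        assms(1,3) smooth_k smooth_n)

  have der_\<alpha>: "(\<alpha> has_vector_derivative t s) (at s)"
    and der_t: "(t has_vector_derivative t' s) (at s)"
    and der_n: "(n has_vector_derivative n' s) (at s)"
    and der_k: "(k has_vector_derivative k' s) (at s)" if "s \<in> I" for s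
    using that t smooth_on_has_vector_derivative[OF _ that] assms(3) smooth_t smooth_n smooth_k
    by (force simp: t'_def n'_def k'_def)+
  have tt: "t s \<bullet> t s = 1" if "s \<in> I" for s
    using assms(4) t that by (simp add: arc_length_parametrized_def norm_eq_1)
  have nn: "n s \<bullet> n s = 1" if "s \<in> I" for s
    unfolding norm_eq_1[symmetric] n[OF that, symmetric]
    using \<kappa>[OF that] \<kappa>_neq[OF that] by (simp add: k_def)
  have tn: "t s \<bullet> n s = 0" if "s \<in> I" for s
  proof -
    \<comment> \<open>The tangent has constant length, so it is orthogonal to its derivative.\<close>
    have "t s \<bullet> t' s + t' s \<bullet> t s = 0"
      using has_vector_derivative_const_on_open[OF assms(1) that tt
          bounded_bilinear.has_vector_derivative[OF bounded_bilinear_inner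
            der_t[OF that] der_t[OF that]]] by blast
    then show ?thesis
      by (simp add: n[OF that, symmetric] inner_commute)
  qed
  have tn': "t s \<bullet> n' s = - \<kappa> s" if "s \<in> I" for s
  proof -
    have "t s \<bullet> n' s + t' s \<bullet> n s = 0"
      using has_vector_derivative_const_on_open[OF assms(1) that tn
          bounded_bilinear.has_vector_derivative[OF bounded_bilinear_inner
            der_t[OF that] der_n[OF that]]] by blast
    then show ?thesis
      by (simp add: t'_eq[OF that] nn[OF that])
  qed
  have norm_b: "norm (b s) = 1" if "s \<in> I" for s
    using norm_cross[of "t s" "n s"] tt[OF that] nn[OF that] tn[OF that] b[OF that]
    by (simp add: power2_norm_eq_inner norm_eq_1)

  have der_x: "vector_derivative (\<lambda>s. \<alpha> s + k s *\<^sub>R n s) (at s) =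
      t s + ((1 / \<kappa> s) *\<^sub>R n' s + k' s *\<^sub>R n s)" if "s \<in> I" for s
    using has_vector_derivative_add[OF der_\<alpha>[OF that]
        bounded_bilinear.has_vector_derivative[OF bounded_bilinear_scaleR
          der_k[OF that] der_n[OF that]]]
    by (simp add: vector_derivative_at k_def)
  have der_b: "vector_derivative b (at s) = cross3 (t s) (n' s) + cross3 (\<kappa> s *\<^sub>R n s) (n s)"
    if "s \<in> I" for s
    using has_vector_derivative_transform_within_open[OF
        bounded_bilinear.has_vector_derivative[OF bounded_bilinear_cross3
          der_t[OF that] der_n[OF that]] assms(1) that b]
    by (simp add: vector_derivative_at t'_eq[OF that])
  have "det (vector [vector_derivative (\<lambda>s. \<alpha> s + k s *\<^sub>R n s) (at s), b s,
      vector_derivative b (at s)] :: real^3^3) = 0" if "s \<in> I" for s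
    unfolding der_x[OF that] der_b[OF that] b[OF that, symmetric]
    using tt[OF that] tn[OF that] tn'[OF that] \<kappa>_neq[OF that]
    by (rule det_curvature_axis_eq_0)
  then have "developable I (\<lambda>s. \<alpha> s + k s *\<^sub>R n s) b R"
    using smooth_x smooth_b norm_b assms(7)
    by (simp add: developable_def ruled_surface_def k_def)
  moreover have "\<forall>s\<in>I. range (R s) = curvature_axis \<alpha> n b \<kappa> s"
    using assms(7) by (auto simp: curvature_axis_def)
  ultimately show ?thesis
    by (simp add: k_def)
qed

end
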